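(* Let $a,b$ be odd positive integers and $n$ a positive integer. Then $$N(a,a,2a,b;2n+a+b)=\frac 13\Big(N(a,a,a,2b;4n+2a+2b)+2N\big(a,a,a,2b;n+\tfrac{a+b}2\big)\Big)$$ and $$t(a,2a,4a,b;n)=\frac 16\Big(N(a,a,a,2b;16n+14a+2b)-N\big(a,a,a,2b;4n+\tfrac{7a+b}2\big)\Big).$$
   Context: For positive integers $a_1,\dots,a_k$ and a nonnegative integer $n$, $N(a_1,\dots,a_k;n)$ is the number of $(x_1,\dots,x_k)\in\mathbb Z^k$ with $n=a_1x_1^2+\cdots+a_kx_k^2$, and $t(a_1,\dots,a_k;n)$ is the number of $(x_1,\dots,x_k)\in\mathbb Z^k$ with $n=a_1\frac{x_1(x_1-1)}2+\cdots+a_k\frac{x_k(x_k-1)}2$. *)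

theory Defs
  imports Complex_Main
begin

text \<open>
  The list \<open>as\<close> holds the coefficients \<open>a\<^sub>1, \<dots>, a\<^sub>k\<close>, so \<open>\<int>\<^sup>k\<close> is the set of integer
  lists of length \<open>length as\<close>. The solution sets are finite when all coefficients are
  positive, which is the only case of interest (\<open>card\<close> of an infinite set would be \<open>0\<close>).
\<close>

definition num_squares :: "nat list \<Rightarrow> nat \<Rightarrow> nat" where
  "num_squares as n =
     card {xs :: int list. length xs = length as \<and>
             int n = (\<Sum>i<length as. int (as ! i) * (xs ! i)\<^sup>2)}"

text \<open>The division below is exact, since \<open>x * (x - 1)\<close> is even.\<close>

definition num_triangular :: "nat list \<Rightarrow> nat \<Rightarrow> nat" where
  "num_triangular as n =
     card {xs :: int list. length xs = length as \<and>
             int n = (\<Sum>i<length as. int (as ! i) * (xs ! i * (xs ! i - 1) div 2))}"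

end

theory Submission
  imports Defs
begin

text \<open>
  Put \<open>4k\<close> for the argument of \<open>N(a,a,a,2b; \<cdot>)\<close>. In a solution of
  \<open>a(x\<^sup>2 + y\<^sup>2 + z\<^sup>2) + 2bw\<^sup>2 = 4k\<close> either \<open>x, y, z\<close> are all even, and then so is \<open>w\<close>,
  which gives \<open>N(a,a,a,2b; k)\<close>, or exactly one of them is even. The solutions with \<open>z\<close> even
  are counted by \<open>N(a,a,2a,b; 2k)\<close>, through \<open>(x, y, z) = (u + v, u - v, 2s)\<close>. This gives the
  first identity by inclusion and exclusion. If moreover \<open>x, y\<close> are odd, exactly one of
  \<open>u, v\<close> is even; when \<open>2k = 8n + 7a + b\<close>, writing this one as \<open>2r\<close> leads to
  \<open>av\<^sup>2 + 2as\<^sup>2 + 4ar\<^sup>2 + bw\<^sup>2 = 8n + 7a + b\<close> with \<open>v\<close> odd, and a congruence modulo 8 forces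
  all variables to be odd, which is the equation for the triangular numbers.
\<close>

section \<open>Quaternary forms: from lists to quadruples, and finiteness\<close>

definition quaternary_reps :: "int \<Rightarrow> int \<Rightarrow> int \<Rightarrow> int \<Rightarrow> int \<Rightarrow> (int \<times> int \<times> int \<times> int) set" where
  "quaternary_reps a b c d m = {(x, y, z, w). a * x\<^sup>2 + b * y\<^sup>2 + c * z\<^sup>2 + d * w\<^sup>2 = m}"

lemma card_lists_length_4:
  "card {xs :: 'a list. length xs = 4 \<and> P (xs ! 0) (xs ! 1) (xs ! 2) (xs ! 3)} =
   card {(x, y, z, w). P x y z w}"
proof (rule bij_betw_same_card)
  show "bij_betw (\<lambda>xs. (xs ! 0, xs ! 1, xs ! 2, xs ! 3))
     {xs :: 'a list. length xs = 4 \<and> P (xs ! 0) (xs ! 1) (xs ! 2) (xs ! 3)}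
     {(x, y, z, w). P x y z w}"
    by (rule bij_betw_byWitness[where f' = "\<lambda>(x, y, z, w). [x, y, z, w]"])
       (auto simp: numeral_eq_Suc length_Suc_conv)
qed

lemma num_squares_4:
  "num_squares [a, b, c, d] m = card (quaternary_reps (int a) (int b) (int c) (int d) (int m))"
  using card_lists_length_4[of "\<lambda>x y z w. int m = int a * x\<^sup>2 + int b * y\<^sup>2 + int c * z\<^sup>2 + int d * w\<^sup>2"]
  unfolding num_squares_def quaternary_reps_def
  by (simp add: numeral_eq_Suc eq_commute[of "int m"])

lemma num_triangular_4:
  "num_triangular [a, b, c, d] m =
   card {(x, y, z, w). int m = int a * (x * (x - 1) div 2) + int b * (y * (y - 1) div 2)
     + int c * (z * (z - 1) div 2) + int d * (w * (w - 1) div 2)}"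
  using card_lists_length_4[of "\<lambda>x y z w. int m = int a * (x * (x - 1) div 2)
     + int b * (y * (y - 1) div 2) + int c * (z * (z - 1) div 2) + int d * (w * (w - 1) div 2)"]
  unfolding num_triangular_def by (simp add: numeral_eq_Suc)

lemma abs_le_if_square_le:
  fixes x m :: int
  assumes "x\<^sup>2 \<le> m"
  shows "x \<in> {-m..m}"
proof -
  have "\<bar>x\<bar> \<le> x\<^sup>2"
    using self_le_power[of "\<bar>x\<bar>" 2] by (cases "x = 0") auto
  with assms show ?thesis by auto
qed

text \<open>Positive integer coefficients are at least 1, so every square is at most
  \<open>m\<close> and all solutions lie in a box. Finiteness is what lets cardinalities add over
  disjoint unions later.\<close>

lemma finite_quaternary_reps:
  assumes "a > 0" "b > 0" "c > 0" "d > 0"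
  shows "finite (quaternary_reps a b c d m)"
proof (rule finite_subset)
  show "quaternary_reps a b c d m \<subseteq> {-m..m} \<times> {-m..m} \<times> {-m..m} \<times> {-m..m}"
  proof (rule subrelI)
    fix x yzw
    assume "(x, yzw) \<in> quaternary_reps a b c d m"
    moreover obtain y z w where yzw: "yzw = (y, z, w)" by (cases yzw)
    ultimately have "(x, y, z, w) \<in> quaternary_reps a b c d m" by simp
    then have eq: "a * x\<^sup>2 + b * y\<^sup>2 + c * z\<^sup>2 + d * w\<^sup>2 = m"
      by (simp add: quaternary_reps_def)
    have sq: "t\<^sup>2 \<le> e * t\<^sup>2" "0 \<le> t\<^sup>2" if "e > 0" for e t :: int
      using that mult_right_mono[of 1 e "t\<^sup>2"] by auto
    have "x\<^sup>2 \<le> m" "y\<^sup>2 \<le> m" "z\<^sup>2 \<le> m" "w\<^sup>2 \<le> m"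
      using eq sq[OF assms(1), of x] sq[OF assms(2), of y] sq[OF assms(3), of z]
        sq[OF assms(4), of w] by linarith+
    then show "(x, yzw) \<in> {-m..m} \<times> {-m..m} \<times> {-m..m} \<times> {-m..m}"
      unfolding yzw by (intro SigmaI abs_le_if_square_le)
  qed
qed auto

text \<open>The square of \<open>2 * k + 1\<close> is \<open>4 * (k * (k + 1)) + 1\<close>, and one
  of two consecutive integers is even.\<close>

lemma odd_square_mod_8:
  fixes x :: int
  assumes "odd x"
  obtains q where "x\<^sup>2 = 8 * q + 1"
proof -
  obtain k where k: "x = 2 * k + 1" using assms by (rule oddE)
  obtain q where q: "k * (k + 1) = 2 * q" by (metis dvdE even_mult_iff even_plus_one_iff)
  have "x\<^sup>2 = 8 * q + 1" using k q by (simp add: power2_eq_square algebra_simps)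
  then show ?thesis by (rule that)
qed

section \<open>Parity classes of the solutions\<close>

locale odd_coefficients =
  fixes a b k :: int
  assumes odd_a: "odd a" and odd_b: "odd b" and pos_a: "a > 0" and pos_b: "b > 0"
begin

text \<open>The parameter \<open>k\<close> stays free because the two identities need different
  values of it.\<close>

definition "reps = quaternary_reps a a a (2 * b) (4 * k)"

definition "reps_all_even = {(x, y, z, w) \<in> reps. even x \<and> even y \<and> even z}"

definition "reps_third_even = {(x, y, z, w) \<in> reps. odd x \<and> odd y \<and> even z}"

lemma reps_iff: "(x, y, z, w) \<in> reps \<longleftrightarrow> a * x\<^sup>2 + a * y\<^sup>2 + a * z\<^sup>2 + 2 * b * w\<^sup>2 = 4 * k"
  by (simp add: reps_def quaternary_reps_def)

lemma finite_reps: "finite reps"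
  unfolding reps_def using pos_a pos_b by (intro finite_quaternary_reps) auto

lemma reps_parity:
  assumes "(x, y, z, w) \<in> reps"
  shows "even (x + y + z)"
proof -
  have "even (a * x\<^sup>2 + a * y\<^sup>2 + a * z\<^sup>2 + 2 * b * w\<^sup>2)"
    using assms unfolding reps_iff by simp
  then show ?thesis using odd_a by auto
qed

text \<open>By \<open>reps_parity\<close> the number of odd entries among \<open>x\<close>,
  \<open>y\<close>, \<open>z\<close> is 0 or 2. Since these three share the coefficient
  \<open>a\<close>, swapping coordinates shows that the position of the single even entry does not
  affect the count.\<close>

lemma card_reps: "card reps = card reps_all_even + 3 * card reps_third_even"
proof -
  define X where "X = {(x, y, z, w) \<in> reps. even x \<and> odd y \<and> odd z}"
  define Y where "Y = {(x, y, z, w) \<in> reps. odd x \<and> even y \<and> odd z}"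
  have fin: "finite X" "finite Y" "finite reps_third_even" "finite reps_all_even"
    unfolding X_def Y_def reps_third_even_def reps_all_even_def
    using finite_reps by (auto intro: finite_subset)
  have "reps = reps_all_even \<union> (reps_third_even \<union> (X \<union> Y))"
    unfolding X_def Y_def reps_third_even_def reps_all_even_def using reps_parity by fastforce
  moreover have "X \<inter> Y = {}" "reps_third_even \<inter> (X \<union> Y) = {}"
    "reps_all_even \<inter> (reps_third_even \<union> (X \<union> Y)) = {}"
    by (auto simp: X_def Y_def reps_third_even_def reps_all_even_def)
  ultimately have "card reps = card reps_all_even + (card reps_third_even + (card X + card Y))"
    using fin by (simp add: card_Un_disjoint)
  moreover have "card X = card reps_third_even"
    by (rule bij_betw_same_card[of "\<lambda>(x, y, z, w). (z, y, x, w)"],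
        rule bij_betw_byWitness[where f' = "\<lambda>(x, y, z, w). (z, y, x, w)"])
       (auto simp: X_def reps_third_even_def reps_iff)
  moreover have "card Y = card reps_third_even"
    by (rule bij_betw_same_card[of "\<lambda>(x, y, z, w). (x, z, y, w)"],
        rule bij_betw_byWitness[where f' = "\<lambda>(x, y, z, w). (x, z, y, w)"])
       (auto simp: Y_def reps_third_even_def reps_iff)
  ultimately show ?thesis by simp
qed

lemma card_reps_all_even: "card reps_all_even = card (quaternary_reps a a a (2 * b) k)"
proof (rule bij_betw_same_card[symmetric])
  \<comment> \<open>Substituting the halves and dividing the equation by 2 isolates
    \<open>b * w\<^sup>2\<close> as an even number; \<open>b\<close> is odd.\<close>
  have even_w: "even w" if "(x, y, z, w) \<in> reps_all_even" for x y z w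
  proof -
    have "even x" "even y" "even z" using that by (auto simp: reps_all_even_def)
    then obtain p q r where "x = 2 * p" "y = 2 * q" "z = 2 * r"
      unfolding dvd_def by blast
    then have "b * w\<^sup>2 = 2 * (k - a * p\<^sup>2 - a * q\<^sup>2 - a * r\<^sup>2)"
      using that by (simp add: reps_all_even_def reps_iff power_mult_distrib)
    then have "even (b * w\<^sup>2)" by simp
    then show ?thesis using odd_b by simp
  qed
  define f :: "int \<times> int \<times> int \<times> int \<Rightarrow> int \<times> int \<times> int \<times> int" where
    "f = (\<lambda>(x, y, z, w). (2 * x, 2 * y, 2 * z, 2 * w))"
  have eq: "f (x, y, z, w) \<in> reps_all_even \<longleftrightarrow> (x, y, z, w) \<in> quaternary_reps a a a (2 * b) k"
    for x y z w
    by (auto simp: f_def reps_all_even_def reps_iff quaternary_reps_def power_mult_distrib)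
  have "reps_all_even \<subseteq> f ` quaternary_reps a a a (2 * b) k"
  proof clarify
    fix x y z w assume R: "(x, y, z, w) \<in> reps_all_even"
    then have "even x" "even y" "even z" "even w"
      using even_w[OF R] by (auto simp: reps_all_even_def)
    then have half: "(x, y, z, w) = f (x div 2, y div 2, z div 2, w div 2)"
      by (simp add: f_def)
    have "(x div 2, y div 2, z div 2, w div 2) \<in> quaternary_reps a a a (2 * b) k"
      unfolding eq[symmetric] using R by (simp only: half[symmetric])
    then show "(x, y, z, w) \<in> f ` quaternary_reps a a a (2 * b) k"
      using half by (rule rev_image_eqI)
  qed
  moreover have "f ` quaternary_reps a a a (2 * b) k \<subseteq> reps_all_even"
    using eq by auto
  moreover have "inj_on f (quaternary_reps a a a (2 * b) k)"
    by (auto simp: inj_on_def f_def)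
  ultimately show "bij_betw f (quaternary_reps a a a (2 * b) k) reps_all_even"
    by (auto simp: bij_betw_def)
qed

lemma card_quaternary_reps_1_1_2:
  "card (quaternary_reps a a (2 * a) b (2 * k)) = card reps_all_even + card reps_third_even"
proof -
  have "bij_betw (\<lambda>(u, v, s, w). (u + v, u - v, 2 * s, w))
      (quaternary_reps a a (2 * a) b (2 * k)) (reps_all_even \<union> reps_third_even)"
  proof (rule bij_betw_byWitness[where
        f' = "\<lambda>(x, y, z, w). ((x + y) div 2, (x - y) div 2, z div 2, w)"])
    \<comment> \<open>In both classes \<open>x\<close> and \<open>y\<close> have the same parity and
      \<open>z\<close> is even, so all the halves are exact.\<close>
    have half: "\<exists>u v s. x = u + v \<and> y = u - v \<and> z = 2 * s"
      if "(x, y, z, w) \<in> reps_all_even \<union> reps_third_even" for x y z w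
    proof -
      have "even (x + y)" "even (x - y)" "even z"
        using that by (auto simp: reps_all_even_def reps_third_even_def)
      then have "x = (x + y) div 2 + (x - y) div 2" "y = (x + y) div 2 - (x - y) div 2"
        "z = 2 * (z div 2)"
        by presburger+
      then show ?thesis by blast
    qed
    show "\<forall>p\<in>quaternary_reps a a (2 * a) b (2 * k).
        (case case p of (u, v, s, w) \<Rightarrow> (u + v, u - v, 2 * s, w) of
          (x, y, z, w) \<Rightarrow> ((x + y) div 2, (x - y) div 2, z div 2, w)) = p"
      by auto
    show "\<forall>p\<in>reps_all_even \<union> reps_third_even.
        (case case p of (x, y, z, w) \<Rightarrow> ((x + y) div 2, (x - y) div 2, z div 2, w) of
          (u, v, s, w) \<Rightarrow> (u + v, u - v, 2 * s, w)) = p"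
      using half by fastforce
    have eq: "a * (u + v)\<^sup>2 + a * (u - v)\<^sup>2 + a * (2 * s)\<^sup>2 + 2 * b * w\<^sup>2 =
        2 * (a * u\<^sup>2 + a * v\<^sup>2 + 2 * a * s\<^sup>2 + b * w\<^sup>2)" for u v s w
      by (simp add: power2_eq_square algebra_simps)
    have reps_transform: "(u + v, u - v, 2 * s, w) \<in> reps \<longleftrightarrow>
        (u, v, s, w) \<in> quaternary_reps a a (2 * a) b (2 * k)" for u v s w
      unfolding reps_iff eq by (auto simp: quaternary_reps_def)
    \<comment> \<open>The entries \<open>u + v\<close> and \<open>u - v\<close> have equal parity:
      both even gives the first class, both odd the second.\<close>
    show "(\<lambda>(u, v, s, w). (u + v, u - v, 2 * s, w)) ` quaternary_reps a a (2 * a) b (2 * k)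
        \<subseteq> reps_all_even \<union> reps_third_even"
      by (auto simp: reps_all_even_def reps_third_even_def reps_transform)
    show "(\<lambda>(x, y, z, w). ((x + y) div 2, (x - y) div 2, z div 2, w))
        ` (reps_all_even \<union> reps_third_even) \<subseteq> quaternary_reps a a (2 * a) b (2 * k)"
    proof clarify
      fix x y z w
      assume xyzw: "(x, y, z, w) \<in> reps_all_even \<union> reps_third_even"
      then obtain u v s where uvs: "x = u + v" "y = u - v" "z = 2 * s"
        using half by blast
      have "(x, y, z, w) \<in> reps"
        using xyzw by (auto simp: reps_all_even_def reps_third_even_def)
      then show "((x + y) div 2, (x - y) div 2, z div 2, w)
          \<in> quaternary_reps a a (2 * a) b (2 * k)"
        using reps_transform uvs by simp
    qed
  qed
  then have "card (quaternary_reps a a (2 * a) b (2 * k)) = card (reps_all_even \<union> reps_third_even)"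
    by (rule bij_betw_same_card)
  also have "\<dots> = card reps_all_even + card reps_third_even"
    by (rule card_Un_disjoint)
       (auto simp: reps_all_even_def reps_third_even_def intro: finite_subset[OF _ finite_reps])
  finally show ?thesis .
qed

section \<open>Solutions with two odd entries and triangular numbers\<close>

lemma card_reps_third_even:
  assumes k: "2 * k = 8 * n + 7 * a + b"
  shows "card reps_third_even =
    2 * card {(x, y, z, w). n = a * (x * (x - 1) div 2) + 2 * a * (y * (y - 1) div 2)
      + 4 * a * (z * (z - 1) div 2) + b * (w * (w - 1) div 2)}"
    (is "_ = 2 * card ?T")
proof -
  \<comment> \<open>For odd \<open>x\<close>, \<open>y\<close> exactly one of \<open>x + y\<close>,
    \<open>x - y\<close> is divisible by 4, and negating \<open>y\<close> exchanges the two cases.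
    This is the source of the factor 2.\<close>
  define P where "P = {(x, y, z, w) \<in> reps_third_even. 4 dvd x + y}"
  define Q where "Q = {(x, y, z, w) \<in> reps_third_even. 4 dvd x - y}"
  have fin: "finite P" "finite Q"
    by (auto simp: P_def Q_def reps_third_even_def intro: finite_subset[OF _ finite_reps])
  have "4 dvd x + y \<longleftrightarrow> \<not> 4 dvd x - y" if "odd x" "odd y" for x y :: int
    using that by presburger
  then have "reps_third_even = P \<union> Q" "P \<inter> Q = {}"
    by (auto simp: P_def Q_def reps_third_even_def)
  then have "card reps_third_even = card P + card Q"
    using fin by (simp add: card_Un_disjoint)
  moreover have "card Q = card P"
    by (rule bij_betw_same_card[of "\<lambda>(x, y, z, w). (x, -y, z, w)"],
        rule bij_betw_byWitness[where f' = "\<lambda>(x, y, z, w). (x, -y, z, w)"])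
       (auto simp: P_def Q_def reps_third_even_def reps_iff)
  moreover have "card ?T = card P"
  proof (rule bij_betw_same_card)
    \<comment> \<open>In \<open>P\<close> one has X = 2r + v, Y = 2r - v, Z = 2s. The odd numbers v,
      s, r, W, with coefficients a, 2a, 4a, b, are written as \<open>2 * x - 1\<close>,
      \<open>2 * y - 1\<close>, \<open>2 * z - 1\<close>, \<open>2 * w - 1\<close>.\<close>
    define f :: "int \<times> int \<times> int \<times> int \<Rightarrow> int \<times> int \<times> int \<times> int" where
      "f = (\<lambda>(x, y, z, w). (2 * (2 * z - 1) + (2 * x - 1), 2 * (2 * z - 1) - (2 * x - 1),
        2 * (2 * y - 1), 2 * w - 1))"
    have inj: "inj_on f ?T"
      by (auto simp: inj_on_def f_def)
    have f_reps: "f (x, y, z, w) \<in> reps \<longleftrightarrow> (x, y, z, w) \<in> ?T" for x y z w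
    proof -
      define tri where "tri t = t * (t - 1) div 2" for t :: int
      have tri: "(2 * t - 1)\<^sup>2 = 8 * tri t + 1" for t
      proof -
        have "2 * tri t = t * (t - 1)" by (simp add: tri_def)
        then show ?thesis by (simp add: power2_eq_square algebra_simps)
      qed
      have eq: "a * (2 * r + v)\<^sup>2 + a * (2 * r - v)\<^sup>2 + a * (2 * s)\<^sup>2 + 2 * b * t\<^sup>2 =
          2 * (a * v\<^sup>2 + 2 * a * s\<^sup>2 + 4 * a * r\<^sup>2 + b * t\<^sup>2)" for r v s t
        by (simp add: power2_eq_square algebra_simps)
      have "f (x, y, z, w) \<in> reps \<longleftrightarrow> 2 * (a * (8 * tri x + 1) + 2 * a * (8 * tri y + 1)
          + 4 * a * (8 * tri z + 1) + b * (8 * tri w + 1)) = 4 * k"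
        unfolding f_def prod.case reps_iff eq unfolding tri ..
      \<comment> \<open>The constants 1 contribute a + 2a + 4a + b = 7a + b, exactly the shift in
        \<open>2 * k\<close>.\<close>
      also have "\<dots> \<longleftrightarrow> n = a * tri x + 2 * a * tri y + 4 * a * tri z + b * tri w"
        using k by (auto simp: algebra_simps)
      finally show ?thesis by (simp add: tri_def)
    qed
    have "f ` ?T \<subseteq> P"
    proof
      fix p assume "p \<in> f ` ?T"
      then obtain x y z w where p: "p = f (x, y, z, w)" and "(x, y, z, w) \<in> ?T" by blast
      then have "f (x, y, z, w) \<in> reps" using f_reps by blast
      \<comment> \<open>This is the sum of the first two entries of
        \<open>f (x, y, z, w)\<close>.\<close>
      moreover have "4 dvd 8 * z - (4::int)" by presburger
      ultimately show "p \<in> P"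
        unfolding p by (simp add: f_def P_def reps_third_even_def)
    qed
    moreover have "P \<subseteq> f ` ?T"
    proof clarify
      fix X Y Z W assume "(X, Y, Z, W) \<in> P"
      then have R: "(X, Y, Z, W) \<in> reps" and par: "odd X" "odd Y" "even Z" "4 dvd X + Y"
        by (auto simp: P_def reps_third_even_def)
      define r where "r = (X + Y) div 4"
      define v where "v = X - 2 * r"
      obtain s where Z: "Z = 2 * s" using par by blast
      have X: "X = 2 * r + v" and Y: "Y = 2 * r - v" and "odd v"
        using par by (auto simp: r_def v_def)
      have eq: "a * v\<^sup>2 + 2 * a * s\<^sup>2 + 4 * a * r\<^sup>2 + b * W\<^sup>2 = 8 * n + 7 * a + b"
        using R k unfolding reps_iff X Y Z by (simp add: power2_eq_square algebra_simps)
      \<comment> \<open>Oddness is now propagated in the order \<open>W\<close>, \<open>s\<close>,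
        \<open>r\<close>. Modulo 2 only the terms in \<open>v\<close> and \<open>W\<close>
        survive.\<close>
      have "even (a * v\<^sup>2 + b * W\<^sup>2)"
      proof -
        have "even (8 * n + 7 * a + b)" using odd_a odd_b by simp
        then show ?thesis unfolding eq[symmetric] by simp
      qed
      then have "odd W" using \<open>odd v\<close> odd_a odd_b by simp
      obtain v' where v': "v\<^sup>2 = 8 * v' + 1" using \<open>odd v\<close> by (rule odd_square_mod_8)
      obtain W' where W': "W\<^sup>2 = 8 * W' + 1" using \<open>odd W\<close> by (rule odd_square_mod_8)
      \<comment> \<open>Since the two odd squares are 1 modulo 8, a + b cancels on both sides, and
        the rest is divided by 2.\<close>
      have sr: "a * (s\<^sup>2 + 2 * r\<^sup>2 - 3) = 4 * (n - a * v' - b * W')"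
        using eq unfolding v' W' by (simp add: algebra_simps)
      then have "even (a * (s\<^sup>2 + 2 * r\<^sup>2 - 3))" by simp
      then have "odd s" using odd_a by simp
      then obtain s' where s': "s\<^sup>2 = 8 * s' + 1" by (rule odd_square_mod_8)
      \<comment> \<open>With \<open>s\<^sup>2 = 8 * s' + 1\<close> the bracket in \<open>sr\<close>
        becomes 8s' + 2r^2 - 2, so a further factor 2 can be removed.\<close>
      have "a * (r\<^sup>2 - 1) = 2 * (n - a * v' - b * W' - 2 * a * s')"
        using sr unfolding s' by (simp add: algebra_simps)
      then have "even (a * (r\<^sup>2 - 1))" by simp
      then have "odd r" using odd_a by simp
      have half: "\<exists>t. c = 2 * t - 1" if "odd c" for c :: int
        using that by presburger
      obtain x y z w where "v = 2 * x - 1" "s = 2 * y - 1" "r = 2 * z - 1" "W = 2 * w - 1"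
        using half[OF \<open>odd v\<close>] half[OF \<open>odd s\<close>] half[OF \<open>odd r\<close>] half[OF \<open>odd W\<close>] by blast
      then have XYZW: "(X, Y, Z, W) = f (x, y, z, w)" by (simp add: f_def X Y Z)
      have "(x, y, z, w) \<in> ?T"
        unfolding f_reps[symmetric] using R by (simp only: XYZW[symmetric])
      then show "(X, Y, Z, W) \<in> f ` ?T"
        using XYZW by (rule rev_image_eqI)
    qed
    ultimately show "bij_betw f ?T P" using inj by (auto simp: bij_betw_def)
  qed
  ultimately show ?thesis by simp
qed

end

section \<open>The two identities, by choice of \<open>k\<close>\<close>

theorem theorem5p10:
  fixes a b n :: nat
  assumes "odd a" and "odd b" and "n > 0"
  shows "real (num_squares [a, a, 2 * a, b] (2 * n + a + b)) =
           1 / 3 * (real (num_squares [a, a, a, 2 * b] (4 * n + 2 * a + 2 * b))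
                    + 2 * real (num_squares [a, a, a, 2 * b] (n + (a + b) div 2)))
       \<and> real (num_triangular [a, 2 * a, 4 * a, b] n) =
           1 / 6 * (real (num_squares [a, a, a, 2 * b] (16 * n + 14 * a + 2 * b))
                    - real (num_squares [a, a, a, 2 * b] (4 * n + (7 * a + b) div 2)))"
proof
  \<comment> \<open>The division is exact because \<open>a\<close> and \<open>b\<close> are both
    odd.\<close>
  define k where "k = n + (a + b) div 2"
  have k: "2 * n + a + b = 2 * k" "4 * n + 2 * a + 2 * b = 4 * k"
    using assms unfolding k_def by presburger+
  interpret odd_coefficients "int a" "int b" "int k"
    using assms by unfold_locales (auto simp: odd_pos)
  \<comment> \<open>Let E and T count \<open>reps_all_even\<close> and
    \<open>reps_third_even\<close>. The left side is E + T, and the right side is ((E + 3T) + 2E) /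
    3.\<close>
  show "real (num_squares [a, a, 2 * a, b] (2 * n + a + b)) =
           1 / 3 * (real (num_squares [a, a, a, 2 * b] (4 * n + 2 * a + 2 * b))
                    + 2 * real (num_squares [a, a, a, 2 * b] (n + (a + b) div 2)))"
    using card_reps card_reps_all_even card_quaternary_reps_1_1_2
    unfolding k k_def[symmetric] by (simp add: num_squares_4 reps_def)
next
  \<comment> \<open>Chosen so that 2k = 8n + 7a + b, as \<open>card_reps_third_even\<close>
    requires; 7a + b is even.\<close>
  define k where "k = 4 * n + (7 * a + b) div 2"
  have k: "8 * n + 7 * a + b = 2 * k" "16 * n + 14 * a + 2 * b = 4 * k"
    using assms unfolding k_def by presburger+
  interpret odd_coefficients "int a" "int b" "int k"
    using assms by unfold_locales (auto simp: odd_pos)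
  have "2 * int k = 8 * int n + 7 * int a + int b"
    using k(1) by linarith
  note card_reps_third_even[OF this]
  \<comment> \<open>With E and T as above, the difference on the right is (E + 3T) - E = 3T, and T
    is twice the triangular count.\<close>
  then show "real (num_triangular [a, 2 * a, 4 * a, b] n) =
           1 / 6 * (real (num_squares [a, a, a, 2 * b] (16 * n + 14 * a + 2 * b))
                    - real (num_squares [a, a, a, 2 * b] (4 * n + (7 * a + b) div 2)))"
    using card_reps card_reps_all_even
    unfolding k k_def[symmetric] by (simp add: num_squares_4 num_triangular_4 reps_def)
qed

end
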